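(* Let $p(x)$ and $r(x)$ be functions that are continuous at zero. Let $y(x)$ be a solution of the second-order $q$-difference equation $$\frac{1}{q}D_{q^{-1}}D_q y(x)+p(x)D_{q^{-1}}y(x)+r(x)y(x)=0 .$$ Let $h(x)$ be an arbitrary function and let $f(x)$ be a solution of the first-order $q$-difference equation $$\frac1q D_{q^{-1}}f(x)=p(x)f(x).$$ Then $$\int f(x)\Big(\frac1q D_{q^{-1}}D_qh(x)+p(x)D_{q^{-1}}h(x)+r(x)h(x)\Big)y(x)\,d_qx=f(x/q)\Big(y(x/q)\,D_{q^{-1}}h(x)-h(x/q)\,D_{q^{-1}}y(x)\Big).$$
   Context: Here $0<q<1$. All functions are complex-valued, defined on a set $A$ with $0\in A$ such that $x\in A$ implies $qx\in A$ and $x/q\in A$. The $q$-derivative is $D_qf(x)=\frac{f(x)-f(qx)}{(1-q)x}$ for $x\ne0$ (and $D_qf(0)=f'(0)$ if this exists); $D_{q^{-1}}$ is the same operator with $q$ replaced by $q^{-1}$, i.e. $D_{q^{-1}}f(x)=\frac{f(x)-f(x/q)}{(1-q^{-1})x}$ for $x\neq0$. An indefinite $q$-integral identity $\int F(x)\,d_qx=G(x)$ means that $G$ is a $q$-antiderivative of $F$: $D_qG(x)=F(x)$ for all nonzero $x$ in the domain. The $q$-difference equations are likewise understood at nonzero $x$. *)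

theory Defs
  imports Complex_Main
begin

text \<open>Functions on a domain \<open>A\<close> are represented by total functions on \<^typ>\<open>complex\<close> of which only the
  values on \<open>A\<close> matter; continuity and differentiability at zero are therefore taken within \<open>A\<close>.\<close>

definition q_domain :: "real \<Rightarrow> complex set \<Rightarrow> bool" where
  "q_domain q A \<longleftrightarrow> 0 \<in> A \<and> (\<forall>x\<in>A. of_real q * x \<in> A \<and> x / of_real q \<in> A)"

text \<open>The operator for \<open>q\<^sup>-\<^sup>1\<close> is the instance \<open>q_deriv A (1 / q)\<close>. The value at
  zero is unspecified if \<open>f'(0)\<close> does not exist.\<close>

definition q_deriv :: "complex set \<Rightarrow> real \<Rightarrow> (complex \<Rightarrow> complex) \<Rightarrow> complex \<Rightarrow> complex" where
  "q_deriv A q f x =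
     (if x \<noteq> 0 then (f x - f (of_real q * x)) / ((1 - of_real q) * x)
      else (SOME D. (f has_field_derivative D) (at 0 within A)))"

text \<open>\<open>has_q_antideriv A q F G\<close> renders the identity \<open>\<integral> F(x) d\<^sub>qx = G(x)\<close>.\<close>

definition has_q_antideriv ::
  "complex set \<Rightarrow> real \<Rightarrow> (complex \<Rightarrow> complex) \<Rightarrow> (complex \<Rightarrow> complex) \<Rightarrow> bool" where
  "has_q_antideriv A q F G \<longleftrightarrow> (\<forall>x\<in>A - {0}. q_deriv A q G x = F x)"

end

theory Submission
  imports Defs
begin

text \<open>Write \<open>D'\<close> for the operator with \<open>1 / q\<close>, and put
  \<open>W(x) = y(x/q) D'h(x) - h(x/q) D'y(x)\<close>, a \<open>q\<close>-Wronskian. The claim is the \<open>q\<close>-analogue of the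
  classical fact that, when \<open>f' = p f\<close>, the function \<open>f\<close> is an integrating factor that puts
  \<open>L h = h'' + p h' + r h\<close> into self-adjoint form, so that Lagrange's identity gives
  \<open>(f (y h' - h y'))' = f (y L h - h L y)\<close>; the last term vanishes because \<open>L y = 0\<close>.

  Everything carries over exactly, without error terms, because \<open>D'\<close> at \<open>x\<close> is the \<open>q\<close>-derivative
  at \<open>x / q\<close>. In particular \<open>W\<close> may be evaluated with \<open>y(x), h(x)\<close> in place of \<open>y(x/q), h(x/q)\<close>
  (\<open>q_wronskian_unshift\<close>), as the two versions differ by multiples of the derivatives that cancel
  in the determinant. Having both versions at hand lets \<open>W(x)\<close> and \<open>W(qx)\<close> be
  written with the same coefficients \<open>y(x), h(x)\<close>, so the \<open>q\<close>-derivative falls on the derivatives alone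
  (\<open>q_deriv_q_wronskian\<close>). The product rule for the factor \<open>f(x/q)\<close> then
  contributes \<open>p(x) f(x) W(x)\<close>, which is the first-order term of the operator.\<close>

lemma q_deriv_inverse_eq:
  assumes "0 < q" and "x \<noteq> 0"
  shows "q_deriv A (1 / q) g x = q_deriv A q g (x / of_real q)"
  using assms
  by (cases "q = 1") (simp_all add: q_deriv_def divide_simps, simp add: algebra_simps)

text \<open>The factor \<open>1 / q\<close> normalises \<open>D'\<close> to the step \<open>(1 - q) x\<close>, which is the one that the
  \<open>q\<close>-derivative at \<open>x\<close> uses; second-order terms and \<open>q\<close>-derivatives of \<open>W\<close> then share a denominator.\<close>

lemma scaled_q_deriv_inverse_eq:
  assumes "0 < q" and "x \<noteq> 0"
  shows "1 / of_real q * q_deriv A (1 / q) g x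
           = (g (x / of_real q) - g x) / ((1 - of_real q) * x)"
  using assms
  by (cases "q = 1") (simp_all add: q_deriv_def divide_simps, simp add: algebra_simps)

text \<open>The product rule in the asymmetric form that evaluates the differentiated shift of \<open>f\<close> through
  \<open>D'\<close>: the \<open>q\<close>-derivative of \<open>x \<mapsto> f(x/q)\<close> compares the values of \<open>f\<close> at \<open>x/q\<close> and \<open>x\<close>.\<close>

lemma q_deriv_shifted_mult:
  assumes "0 < q" and "x \<noteq> 0"
  shows "q_deriv A q (\<lambda>t. f (t / of_real q) * w t) x
           = 1 / of_real q * q_deriv A (1 / q) f x * w x + f x * q_deriv A q w x"
  unfolding scaled_q_deriv_inverse_eq[OF assms]
  using assms by (simp add: q_deriv_def diff_divide_distrib algebra_simps)

text \<open>Since \<open>g(x/q) = g(x) + c D'g(x)\<close> with the same \<open>c\<close> for every \<open>g\<close>, replacing \<open>y(x), h(x)\<close> by the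
  shifted values adds a multiple of one row of the determinant to the other.\<close>

lemma q_wronskian_unshift:
  assumes "0 < q" and "q \<noteq> 1" and "x \<noteq> 0"
  shows "y (x / of_real q) * q_deriv A (1 / q) h x - h (x / of_real q) * q_deriv A (1 / q) y x
           = y x * q_deriv A (1 / q) h x - h x * q_deriv A (1 / q) y x"
proof -
  have step: "g (x / of_real q) = g x - (1 - 1 / of_real q) * x * q_deriv A (1 / q) g x" for g
    using assms by (simp add: q_deriv_def)
  show ?thesis
    unfolding step[of y] step[of h] by (simp add: algebra_simps)
qed

text \<open>Lagrange's identity for the second-order part, the analogue of
  \<open>(y h' - h y')' = y h'' - h y''\<close>.\<close>

lemma q_deriv_q_wronskian:
  assumes "0 < q" and "q \<noteq> 1" and "x \<noteq> 0"
  shows "q_deriv A q (\<lambda>t. y (t / of_real q) * q_deriv A (1 / q) h t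
                            - h (t / of_real q) * q_deriv A (1 / q) y t) x
           = y x * (1 / of_real q * q_deriv A (1 / q) (q_deriv A q h) x)
             - h x * (1 / of_real q * q_deriv A (1 / q) (q_deriv A q y) x)"
    (is "q_deriv A q ?W x = _")
proof -
  have W: "?W x = y x * q_deriv A q h (x / of_real q) - h x * q_deriv A q y (x / of_real q)"
    using q_wronskian_unshift[OF assms] assms by (simp add: q_deriv_inverse_eq)
  \<comment> \<open>At \<open>q x\<close> the original form of \<open>W\<close> already has the coefficients \<open>y(x), h(x)\<close>.\<close>
  have Wq: "?W (of_real q * x) = y x * q_deriv A q h x - h x * q_deriv A q y x"
    using assms by (simp add: q_deriv_inverse_eq)
  have "q_deriv A q ?W x = (?W x - ?W (of_real q * x)) / ((1 - of_real q) * x)"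
    using assms by (simp add: q_deriv_def[of A q ?W])
  then show ?thesis
    unfolding W Wq scaled_q_deriv_inverse_eq[OF assms(1,3)]
    by (simp only:) (simp add: diff_divide_distrib right_diff_distrib)
qed

theorem theorem2p1:
  fixes q :: real and A :: "complex set" and p r y h f :: "complex \<Rightarrow> complex"
  assumes "0 < q" and "q < 1"
    and "q_domain q A"
    and "continuous (at 0 within A) p"
    and "continuous (at 0 within A) r"
    and "\<forall>x\<in>A - {0}. 1 / of_real q * q_deriv A (1 / q) (q_deriv A q y) x
           + p x * q_deriv A (1 / q) y x + r x * y x = 0"
    and "\<forall>x\<in>A - {0}. 1 / of_real q * q_deriv A (1 / q) f x = p x * f x"
  shows "has_q_antideriv A q
           (\<lambda>x. f x * (1 / of_real q * q_deriv A (1 / q) (q_deriv A q h) x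
                        + p x * q_deriv A (1 / q) h x + r x * h x) * y x)
           (\<lambda>x. f (x / of_real q) * (y (x / of_real q) * q_deriv A (1 / q) h x
                                    - h (x / of_real q) * q_deriv A (1 / q) y x))"
proof -
  let ?D = "q_deriv A q" and ?D' = "q_deriv A (1 / q)"
  let ?W = "\<lambda>x. y (x / of_real q) * ?D' h x - h (x / of_real q) * ?D' y x"
  have "?D (\<lambda>t. f (t / of_real q) * ?W t) x
          = f x * (1 / of_real q * ?D' (?D h) x + p x * ?D' h x + r x * h x) * y x"
    if x: "x \<in> A - {0}" for x
  proof -
    have "x \<noteq> 0" "q \<noteq> 1" using x assms(2) by auto
    have f: "1 / of_real q * ?D' f x = p x * f x"
      using assms(7) x by blast
    have y: "1 / of_real q * ?D' (?D y) x = - p x * ?D' y x - r x * y x"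
      using assms(6) x by (simp add: algebra_simps eq_neg_iff_add_eq_0)
    have "?D (\<lambda>t. f (t / of_real q) * ?W t) x = p x * f x * ?W x + f x * ?D ?W x"
      using q_deriv_shifted_mult[where A = A and f = f and w = ?W, OF \<open>0 < q\<close> \<open>x \<noteq> 0\<close>]
      unfolding f .
    also have "\<dots> = p x * f x * (y x * ?D' h x - h x * ?D' y x)
        + f x * (y x * (1 / of_real q * ?D' (?D h) x) - h x * (- p x * ?D' y x - r x * y x))"
      using q_wronskian_unshift[where A = A and y = y and h = h, OF \<open>0 < q\<close> \<open>q \<noteq> 1\<close> \<open>x \<noteq> 0\<close>]
        q_deriv_q_wronskian[where A = A and y = y and h = h, OF \<open>0 < q\<close> \<open>q \<noteq> 1\<close> \<open>x \<noteq> 0\<close>]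
      by (simp only: y)
    also have "\<dots> = f x * (1 / of_real q * ?D' (?D h) x + p x * ?D' h x + r x * h x) * y x"
      by (simp add: algebra_simps)
    finally show ?thesis .
  qed
  then show ?thesis
    unfolding has_q_antideriv_def by blast
qed

end
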